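(* Let $\Omega \subset \mathbb{R}^d$ and $\Gamma \subset \mathbb{R}^s$ be bounded sets. Let $f\colon \Omega \times \Gamma \times \mathbb{R}^s \to \mathbb{R}$ be measurable in the first two, and convex in the third entry, and let $u \in C^2(\Omega;\Gamma)$ be given. Let $\mathbf{u}\colon \Omega \to \mathcal{P}(\Gamma)$ be defined by $\mathbf{u}_x := \delta_{u(x)}$ for each $x\in\Omega$. Then $$F(u) \geq \mathcal{F}(\mathbf{u}),$$ where $$F(u) = \int_\Omega f(x,u(x),\Delta u(x))\, dx$$ and $$\mathcal{F}(\mathbf{u}) = \sup_{(p,q) \in X} \int_{\Omega}\int_{\Gamma} \left(\Delta_x p(x,z) + q(x,z)\right) d\mathbf{u}_x(z)\, dx,$$ with the set $X$ of admissible pairs defined by $$X = \left\{ (p,q) : p \in C_c^2(\Omega \times \Gamma),\ q \in L^1(\Omega \times \Gamma),\ z \mapsto p(x,z) \text{ concave and } q(x,z) + f^*(x,z,\nabla_z p(x,z)) \leq 0 \text{ for every } (x,z) \in \Omega \times \Gamma \right\}.$$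
   Context: The Laplacian $\Delta u$ of a vector-valued function $u\colon\Omega\to\Gamma\subset\mathbb{R}^s$ is understood component-wise, so $\Delta u(x)\in\mathbb{R}^s$. $\mathcal{P}(\Gamma)$ denotes the space of Borel probability measures on $\Gamma$; for $\mathbf{u}\colon\Omega\to\mathcal{P}(\Gamma)$, $\mathbf{u}_x$ denotes its value at $x\in\Omega$. $\delta_{z}$ is the Dirac measure at $z\in\Gamma$. $f^*$ is the convex conjugate of $f$ with respect to the last argument: $f^*(x,z,g) := \sup_{p\in\mathbb{R}^s} \langle g,p\rangle - f(x,z,p)$. $C_c^2(\Omega\times\Gamma)$ denotes the real-valued twice continuously differentiable functions with compact support in $\Omega\times\Gamma$. $\Delta_x p$ is the Laplacian of $p(x,z)$ with respect to $x$ only, and $\nabla_z p$ is the gradient with respect to $z$ only.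
   Formalization: Ω is assumed open (for Ω = [0,1], f = 0, p = x², q = 0 the claim fails), and concavity of z ↦ p(x,z) is required on the convex hull of Γ, which is concavity on Γ when Γ is convex; for non-convex Γ the notion is otherwise undefined. *)

theory Defs
  imports "HOL-Probability.Probability"
begin

definition partial_deriv :: "'a::euclidean_space \<Rightarrow> ('a \<Rightarrow> real) \<Rightarrow> 'a \<Rightarrow> real" where
  "partial_deriv b f x = deriv (\<lambda>t. f (x + t *\<^sub>R b)) 0"

definition gradient :: "('a::euclidean_space \<Rightarrow> real) \<Rightarrow> 'a \<Rightarrow> 'a" where
  "gradient f x = (\<Sum>b\<in>Basis. partial_deriv b f x *\<^sub>R b)"

definition laplacian :: "('a::euclidean_space \<Rightarrow> real) \<Rightarrow> 'a \<Rightarrow> real" where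
  "laplacian f x = (\<Sum>b\<in>Basis. partial_deriv b (partial_deriv b f) x)"

definition vec_laplacian ::
    "('a::euclidean_space \<Rightarrow> 'b::euclidean_space) \<Rightarrow> 'a \<Rightarrow> 'b" where
  "vec_laplacian u x = (\<Sum>c\<in>Basis. laplacian (\<lambda>y. u y \<bullet> c) x *\<^sub>R c)"

(* For open S one may take W = S, and this is the usual notion.  For a set with boundary
   points (such as a product with a compact factor), f is C^2 on a neighbourhood of S, so
   that its derivatives at all points of S are meaningful. *)
definition C2_on ::
    "'a::real_normed_vector set \<Rightarrow> ('a \<Rightarrow> 'b::real_normed_vector) \<Rightarrow> bool" where
  "C2_on S f \<longleftrightarrow>
     (\<exists>W (f' :: 'a \<Rightarrow> 'a \<Rightarrow>\<^sub>L 'b) (f'' :: 'a \<Rightarrow> 'a \<Rightarrow>\<^sub>L 'a \<Rightarrow>\<^sub>L 'b).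
        open W \<and> S \<subseteq> W \<and>
        (\<forall>x\<in>W. (f has_derivative blinfun_apply (f' x)) (at x)) \<and>
        (\<forall>x\<in>W. (f' has_derivative blinfun_apply (f'' x)) (at x)) \<and>
        continuous_on W f'')"

(* Only the values of f on S enter the support; values at points outside S are those of an
   extension and are not required to vanish. *)
definition C2_compact_support :: "'a::real_normed_vector set \<Rightarrow> ('a \<Rightarrow> real) \<Rightarrow> bool" where
  "C2_compact_support S f \<longleftrightarrow>
     C2_on S f \<and> compact (closure {w \<in> S. f w \<noteq> 0}) \<and> closure {w \<in> S. f w \<noteq> 0} \<subseteq> S"

(* Extended-real Lebesgue integral: integral of the positive part minus integral of the
   negative part (e2ennreal truncates negative values to 0).  If both are infinite the
   integral does not exist; the value is then infinity, since infinity - infinity is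
   infinity in ereal. *)
definition ext_integral :: "'a measure \<Rightarrow> ('a \<Rightarrow> ereal) \<Rightarrow> ereal" where
  "ext_integral M g =
     enn2ereal (\<integral>\<^sup>+x. e2ennreal (g x) \<partial>M) - enn2ereal (\<integral>\<^sup>+x. e2ennreal (- g x) \<partial>M)"

definition conjugate ::
    "('a \<Rightarrow> 'b \<Rightarrow> 'b::euclidean_space \<Rightarrow> real) \<Rightarrow> 'a \<Rightarrow> 'b \<Rightarrow> 'b \<Rightarrow> ereal" where
  "conjugate f x z g = (SUP v. ereal (g \<bullet> v - f x z v))"

(* Lebesgue in x and Borel in z: sections h(x, .) can be integrated against Borel measures on
   \<Gamma>, and x \<mapsto> h (x, u x) is Lebesgue measurable for every continuous u. *)
definition measurable_integrand ::
    "'a::euclidean_space set \<Rightarrow> 'b::euclidean_space set \<Rightarrow> ('a \<times> 'b \<Rightarrow> real) \<Rightarrow> bool" where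
  "measurable_integrand \<Omega> \<Gamma> h \<longleftrightarrow>
     h \<in> borel_measurable (lebesgue_on \<Omega> \<Otimes>\<^sub>M restrict_space borel \<Gamma>)"

definition energy ::
    "'a::euclidean_space set \<Rightarrow> ('a \<Rightarrow> 'b \<Rightarrow> 'b \<Rightarrow> real) \<Rightarrow> ('a \<Rightarrow> 'b::euclidean_space) \<Rightarrow> ereal" where
  "energy \<Omega> f u = ext_integral (lebesgue_on \<Omega>) (\<lambda>x. ereal (f x (u x) (vec_laplacian u x)))"

(* Concavity refers to the convex hull because concave_on entails convexity of its domain;
   if \<Gamma> is convex this is concavity on \<Gamma>.  The elements of L^1 are taken to be functions,
   not equivalence classes, as they are evaluated on the (null) graph of u. *)
definition admissible ::
    "'a::euclidean_space set \<Rightarrow> 'b::euclidean_space set \<Rightarrow> ('a \<Rightarrow> 'b \<Rightarrow> 'b \<Rightarrow> real)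
      \<Rightarrow> (('a \<times> 'b \<Rightarrow> real) \<times> ('a \<times> 'b \<Rightarrow> real)) set" where
  "admissible \<Omega> \<Gamma> f =
     {(p, q).
        C2_compact_support (\<Omega> \<times> \<Gamma>) p \<and>
        measurable_integrand \<Omega> \<Gamma> q \<and> set_integrable lebesgue (\<Omega> \<times> \<Gamma>) q \<and>
        (\<forall>x\<in>\<Omega>. concave_on (convex hull \<Gamma>) (\<lambda>z. p (x, z))) \<and>
        (\<forall>x\<in>\<Omega>. \<forall>z\<in>\<Gamma>. ereal (q (x, z)) + conjugate f x z (gradient (\<lambda>w. p (x, w)) z) \<le> 0)}"

definition lifted_energy ::
    "'a::euclidean_space set \<Rightarrow> 'b::euclidean_space set \<Rightarrow> ('a \<Rightarrow> 'b \<Rightarrow> 'b \<Rightarrow> real)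
      \<Rightarrow> ('a \<Rightarrow> 'b measure) \<Rightarrow> ereal" where
  "lifted_energy \<Omega> \<Gamma> f U =
     (SUP (p, q) \<in> admissible \<Omega> \<Gamma> f.
        ext_integral (lebesgue_on \<Omega>)
          (\<lambda>x. ext_integral (U x) (\<lambda>z. ereal (laplacian (\<lambda>y. p (y, z)) x + q (x, z)))))"

end

theory Submission imports Defs begin

text \<open>
  Fix an admissible pair \<open>(p, q)\<close>. Admissibility bounds \<open>q\<close> by the Fenchel inequality,
  tested with the vector \<open>\<Delta>u(x)\<close> on the graph of \<open>u\<close>:
  \<open>q(x, u(x)) \<le> f(x, u(x), \<Delta>u(x)) - \<langle>\<nabla>\<^sub>z p(x, u(x)), \<Delta>u(x)\<rangle>\<close>.
  Hence it suffices that \<open>\<Delta>\<^sub>x p(x, u(x)) - \<langle>\<nabla>\<^sub>z p(x, u(x)), \<Delta>u(x)\<rangle>\<close>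
  is bounded above by a function with integral zero. That function is the divergence of the flux
  \<open>V = \<nabla>\<^sub>x p(x, u(x)) - \<nabla>\<^sub>z p(x, u(x)) Du(x)\<close>: by the chain rule and the symmetry of the second
  derivative, the mixed terms cancel and
  \<open>div V = \<Delta>\<^sub>x p - \<langle>\<nabla>\<^sub>z p, \<Delta>u\<rangle> - (\<Sum>i. D\<^sub>z\<^sub>z p [\<partial>\<^sub>i u, \<partial>\<^sub>i u])\<close>,
  where the last sum is nonpositive because \<open>p(x, \<cdot>)\<close> is concave. This is lemma
  \<open>laplacian_le_divergence_flux\<close>.

  Two points need care because \<open>\<Gamma>\<close> is an arbitrary bounded set, possibly without interior, so that
  the derivatives of \<open>p\<close> in \<open>z\<close> are not determined by its values on \<open>\<Omega> \<times> \<Gamma>\<close>. First,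
  \<open>\<nabla>\<^sub>z p\<close> need not vanish where \<open>p\<close> vanishes on \<open>\<Gamma>\<close>; the flux nevertheless has compact support,
  since \<open>V\<^sub>i = 2 \<partial>\<^sub>x\<^sub>i p(x, u(x)) - \<partial>\<^sub>i (p(x, u(x)))\<close> involves only values of \<open>p\<close> on \<open>\<Omega> \<times> \<Gamma>\<close>
  (\<open>flux_eq_0_outside_support\<close>). Second, the convex hull of \<open>\<Gamma>\<close>, on which \<open>p(x, \<cdot>)\<close> is concave, need
  not contain a segment through \<open>u(x)\<close> in the direction \<open>\<partial>\<^sub>i u\<close>; the second derivative in this direction
  is nonpositive because the direction is tangent to a curve in \<open>\<Gamma>\<close>
  (\<open>second_derivative_nonpos_if_concave_along_curve\<close>).

  Finally, the divergence integrates to zero by translation invariance of Lebesgue measure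
  (\<open>integral_partial_derivative_compact_support\<close>). As the integrals are extended-real valued, it
  is subtracted from the dual integrand, which is measurable, rather than added to the energy
  density, and the two are then compared by monotonicity of the integral.
\<close>

section \<open>Derivatives along curves\<close>

lemma has_vector_derivative_along_curve:
  assumes "(c has_vector_derivative c') (at t)" "(P has_derivative D) (at (c t))"
  shows "((\<lambda>t. P (c t)) has_vector_derivative D c') (at t)"
  using vector_derivative_diff_chain_within[OF assms(1) has_derivative_at_withinI[OF assms(2)]]
  by (simp add: o_def)

lemma blinfun_has_vector_derivative_along_curve:
  assumes "(c has_vector_derivative c') (at t)"
    and "(P' has_derivative blinfun_apply P'') (at (c t))"
    and "(v has_vector_derivative v') (at t)"
  shows "((\<lambda>t. blinfun_apply (P' (c t)) (v t))
           has_vector_derivative (P' (c t) v' + P'' c' (v t))) (at t)"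
  by (rule bounded_bilinear.has_vector_derivative[OF bounded_bilinear_blinfun_apply
        has_vector_derivative_along_curve[OF assms(1,2)] assms(3)])

lemma has_vector_derivative_line:
  "((\<lambda>t. x + t *\<^sub>R b) has_vector_derivative b) (at t)"
  by (auto intro!: derivative_eq_intros)

lemma has_vector_derivative_on_line:
  assumes "(g has_derivative D) (at x)"
  shows "((\<lambda>t. g (x + t *\<^sub>R b)) has_vector_derivative D b) (at 0)"
  using has_vector_derivative_along_curve[OF has_vector_derivative_line[of x b 0], of g D] assms
  by simp

lemma open_line_vimage:
  fixes A :: "'a::real_normed_vector set"
  assumes "open A"
  shows "open {t::real. x + t *\<^sub>R b \<in> A}"
proof -
  have "open ((\<lambda>t::real. x + t *\<^sub>R b) -` A)"
    by (intro open_vimage assms continuous_intros)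
  then show ?thesis
    by (simp add: vimage_def)
qed

section \<open>Symmetry of the second derivative\<close>

text \<open>
  The mean value theorem, applied in the direction \<open>h\<close> and then in the direction \<open>k\<close>. The left-hand
  side is symmetric in \<open>h\<close> and \<open>k\<close>, which is what makes the second derivative symmetric.
\<close>

lemma second_difference_quotient:
  fixes g :: "'a::real_normed_vector \<Rightarrow> real" and g' :: "'a \<Rightarrow> 'a \<Rightarrow>\<^sub>L real"
    and g'' :: "'a \<Rightarrow> 'a \<Rightarrow>\<^sub>L 'a \<Rightarrow>\<^sub>L real"
  assumes g': "\<And>x. x \<in> ball z r \<Longrightarrow> (g has_derivative g' x) (at x)"
    and g'': "\<And>x. x \<in> ball z r \<Longrightarrow> (g' has_derivative g'' x) (at x)"
    and t: "0 < t" "t * (norm h + norm k) < r"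
  obtains y where "y \<in> ball z r"
    "g (z + t *\<^sub>R h + t *\<^sub>R k) - g (z + t *\<^sub>R h) - g (z + t *\<^sub>R k) + g z = t^2 * g'' y k h"
proof -
  have mem: "z + a *\<^sub>R h + b *\<^sub>R k \<in> ball z r" if "0 \<le> a" "a \<le> t" "0 \<le> b" "b \<le> t" for a b
  proof -
    have "norm (a *\<^sub>R h + b *\<^sub>R k) \<le> a * norm h + b * norm k"
      using norm_triangle_ineq[of "a *\<^sub>R h" "b *\<^sub>R k"] that by simp
    also have "\<dots> \<le> t * norm h + t * norm k"
      using that by (intro add_mono mult_right_mono) auto
    also have "\<dots> < r"
      using t by (simp add: distrib_left)
    finally have "dist z (z + (a *\<^sub>R h + b *\<^sub>R k)) < r"
      by (simp only: dist_add_cancel[of z 0, simplified] dist_0_norm)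
    then show ?thesis
      by (simp add: add.assoc)
  qed
  let ?A = "\<lambda>s. g (z + s *\<^sub>R h + t *\<^sub>R k) - g (z + s *\<^sub>R h)"
  have h_line: "((\<lambda>s. z + s *\<^sub>R h + w) has_vector_derivative h) (at s)" for s w
    by (auto intro!: derivative_eq_intros)
  have "(?A has_real_derivative (g' (z + s *\<^sub>R h + t *\<^sub>R k) h - g' (z + s *\<^sub>R h) h)) (at s)"
    if "0 \<le> s" "s \<le> t" for s
  proof -
    have "((\<lambda>s. g (z + s *\<^sub>R h + t *\<^sub>R k)) has_vector_derivative g' (z + s *\<^sub>R h + t *\<^sub>R k) h) (at s)"
      by (rule has_vector_derivative_along_curve[OF h_line g'[OF mem]]) (use that t in auto)
    moreover have "((\<lambda>s. g (z + s *\<^sub>R h)) has_vector_derivative g' (z + s *\<^sub>R h) h) (at s)"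
      by (rule has_vector_derivative_along_curve[OF has_vector_derivative_line g'])
         (use that t mem[of s 0] in auto)
    ultimately show ?thesis
      unfolding has_real_derivative_iff_has_vector_derivative by (rule has_vector_derivative_diff)
  qed
  from MVT2[OF t(1) this] obtain s where s: "0 < s" "s < t"
    and A: "?A t - ?A 0 = t * (g' (z + s *\<^sub>R h + t *\<^sub>R k) h - g' (z + s *\<^sub>R h) h)"
    by auto
  let ?B = "\<lambda>r. g' (z + s *\<^sub>R h + r *\<^sub>R k) h"
  have "(?B has_real_derivative g'' (z + s *\<^sub>R h + q *\<^sub>R k) k h) (at q)" if "0 \<le> q" "q \<le> t" for q
    unfolding has_real_derivative_iff_has_vector_derivative
    using blinfun_has_vector_derivative_along_curve[OF has_vector_derivative_line g''[OF mem]
        has_vector_derivative_const[of h], of s q] s that by simp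
  from MVT2[OF t(1) this] obtain q where q: "0 < q" "q < t"
    and B: "?B t - ?B 0 = t * g'' (z + s *\<^sub>R h + q *\<^sub>R k) k h"
    by auto
  show ?thesis
    by (rule that[of "z + s *\<^sub>R h + q *\<^sub>R k"])
       (use mem s q A B in \<open>auto simp: power2_eq_square\<close>)
qed

text \<open>
  If the two values at \<open>z\<close> differed, continuity would separate them by a constant \<open>c\<close> on a whole
  ball, whereas the second difference quotient takes a value of each kind in that ball.
\<close>

lemma second_derivative_symmetric:
  fixes g :: "'a::real_normed_vector \<Rightarrow> real" and g' :: "'a \<Rightarrow> 'a \<Rightarrow>\<^sub>L real"
    and g'' :: "'a \<Rightarrow> 'a \<Rightarrow>\<^sub>L 'a \<Rightarrow>\<^sub>L real"
  assumes "open W" "z \<in> W"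
    and g': "\<And>x. x \<in> W \<Longrightarrow> (g has_derivative g' x) (at x)"
    and g'': "\<And>x. x \<in> W \<Longrightarrow> (g' has_derivative g'' x) (at x)"
    and cont: "continuous_on W g''"
  shows "g'' z h k = g'' z k h"
proof -
  have False if less: "g'' z k h < g'' z h k" for h k
  proof -
    define c where "c = (g'' z k h + g'' z h k) / 2"
    have c: "g'' z k h < c" "c < g'' z h k"
      using less by (auto simp: c_def)
    have cont_eval: "continuous_on W (\<lambda>x. g'' x a b)" for a b
      by (intro blinfun.continuous_on cont continuous_on_const)
    have "open (W \<inter> (\<lambda>x. g'' x k h) -` {..<c} \<inter> (W \<inter> (\<lambda>x. g'' x h k) -` {c<..}))" (is "open ?N")
      using \<open>open W\<close> by (intro open_Int continuous_open_preimage cont_eval) auto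
    moreover have "z \<in> ?N"
      using c \<open>z \<in> W\<close> by simp
    ultimately obtain r where r: "0 < r" "ball z r \<subseteq> ?N"
      by (rule openE)
    define t where "t = r / (2 * (norm h + norm k + 1))"
    have pos: "0 < norm h + norm k + 1"
      by (simp add: add_nonneg_pos)
    have t: "0 < t" "t * (norm h + norm k) < r"
    proof -
      show "0 < t"
        using r pos by (simp add: t_def)
      then have "t * (norm h + norm k) \<le> t * (norm h + norm k + 1)"
        by simp
      also have "\<dots> = r / 2"
        using pos unfolding t_def by (simp add: divide_simps)
      also have "\<dots> < r"
        using r by simp
      finally show "t * (norm h + norm k) < r" .
    qed
    have d: "(g has_derivative g' x) (at x)" "(g' has_derivative g'' x) (at x)"
      if "x \<in> ball z r" for x
      using that r g' g'' by auto
    obtain y where y: "y \<in> ball z r"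
      "g (z + t *\<^sub>R h + t *\<^sub>R k) - g (z + t *\<^sub>R h) - g (z + t *\<^sub>R k) + g z = t^2 * g'' y k h"
      using second_difference_quotient[OF d t] by metis
    have t': "t * (norm k + norm h) < r"
      using t by (simp add: add.commute)
    obtain y' where y': "y' \<in> ball z r"
      "g (z + t *\<^sub>R k + t *\<^sub>R h) - g (z + t *\<^sub>R k) - g (z + t *\<^sub>R h) + g z = t^2 * g'' y' h k"
      using second_difference_quotient[OF d t(1) t'] by metis
    have "t^2 * g'' y k h = t^2 * g'' y' h k"
      using y(2) y'(2) by (simp add: algebra_simps)
    then have "g'' y k h = g'' y' h k"
      using t by simp
    moreover have "g'' y k h < c" "c < g'' y' h k"
      using r(2) y(1) y'(1) by auto
    ultimately show False
      by simp
  qed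
  from this[of h k] this[of k h] show ?thesis
    by (meson linorder_less_linear)
qed

section \<open>Concavity and second derivatives\<close>

lemma second_derivative_nonneg_at_minimum:
  fixes \<psi> \<psi>' :: "real \<Rightarrow> real"
  assumes "open S" "a \<in> S"
    and deriv: "\<And>t. t \<in> S \<Longrightarrow> (\<psi> has_real_derivative \<psi>' t) (at t)"
    and deriv2: "(\<psi>' has_real_derivative c) (at a)"
    and min: "\<And>t. t \<in> S \<Longrightarrow> \<psi> a \<le> \<psi> t"
  shows "0 \<le> c"
proof (rule ccontr)
  assume "\<not> 0 \<le> c"
  obtain r where r: "0 < r" "ball a r \<subseteq> S"
    using assms(1,2) by (meson openE)
  have "\<psi>' a = 0"
    by (rule DERIV_local_min[OF deriv[OF \<open>a \<in> S\<close>] r(1)])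
       (use r min in \<open>auto simp: dist_real_def subset_iff\<close>)
  with DERIV_neg_dec_right[OF deriv2] \<open>\<not> 0 \<le> c\<close>
  obtain d where d: "0 < d" "\<And>h. 0 < h \<Longrightarrow> h < d \<Longrightarrow> \<psi>' (a + h) < 0"
    by auto
  define h where "h = min d r / 2"
  have h: "0 < h" "h < d" "h < r"
    using d r by (auto simp: h_def)
  have mem: "t \<in> S" if "a \<le> t" "t \<le> a + h" for t
    using that h r by (auto simp: dist_real_def subset_iff)
  have "\<exists>t>a. t < a + h \<and> \<psi> (a + h) - \<psi> a = (a + h - a) * \<psi>' t"
    by (rule MVT2) (use h mem deriv in auto)
  then obtain t where t: "a < t" "t < a + h" "\<psi> (a + h) - \<psi> a = h * \<psi>' t"
    by auto
  have "\<psi>' t < 0"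
    using d(2)[of "t - a"] t h by auto
  then have "\<psi> (a + h) < \<psi> a"
    using t(3) mult_pos_neg[OF h(1)] by fastforce
  with min[OF mem[of "a + h"]] h show False
    by simp
qed

text \<open>
  The set \<open>S\<close> may be so thin that no segment in the direction \<open>c' 0\<close> lies in it, so concavity cannot
  be tested on a line. Instead it is tested on the chord from \<open>c t\<close> to \<open>c (- t)\<close>: the value of \<open>P\<close>
  at the midpoint minus the mean of the values at the end points is nonnegative and vanishes at
  \<open>t = 0\<close>. The acceleration \<open>c''\<close> contributes equally to both and cancels, which leaves
  \<open>- P'' (c' 0) (c' 0)\<close> as second derivative at this minimum.
\<close>

lemma second_derivative_nonpos_if_concave_along_curve:
  fixes P :: "'a::real_normed_vector \<Rightarrow> real" and P' :: "'a \<Rightarrow> 'a \<Rightarrow>\<^sub>L real"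
    and P'' :: "'a \<Rightarrow>\<^sub>L 'a \<Rightarrow>\<^sub>L real" and c c' :: "real \<Rightarrow> 'a"
  assumes "open W" "c 0 \<in> W" and conc: "concave_on S P"
    and P': "\<And>x. x \<in> W \<Longrightarrow> (P has_derivative P' x) (at x)"
    and P'': "(P' has_derivative P'') (at (c 0))"
    and "0 < r" and c': "\<And>t. \<bar>t\<bar> < r \<Longrightarrow> (c has_vector_derivative c' t) (at t)"
    and c'': "(c' has_vector_derivative c'') (at 0)"
    and cS: "\<And>t. \<bar>t\<bar> < r \<Longrightarrow> c t \<in> S"
  shows "P'' (c' 0) (c' 0) \<le> 0"
proof -
  let ?m = "\<lambda>t. (1/2) *\<^sub>R (c t + c (- t))"
  let ?m' = "\<lambda>t. (1/2) *\<^sub>R (c' t - c' (- t))"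
  let ?\<psi> = "\<lambda>t. P (?m t) - (P (c t) + P (c (- t))) / 2"
  let ?\<psi>' = "\<lambda>t. P' (?m t) (?m' t) - (P' (c t) (c' t) - P' (c (- t)) (c' (- t))) / 2"
  let ?I = "{-r<..<r}"
  have refl: "((\<lambda>t. F (- t)) has_vector_derivative - F') (at t)"
    if "(F has_vector_derivative F') (at (- t))" for F :: "real \<Rightarrow> 'b::real_normed_vector" and F' t
  proof -
    have "((\<lambda>t. - t) has_vector_derivative (-1::real)) (at t)"
      by (auto intro!: derivative_eq_intros)
    from vector_diff_chain_at[OF this that] show ?thesis
      by (simp add: o_def)
  qed
  have refl_c: "((\<lambda>t. c (- t)) has_vector_derivative - c' (- t)) (at t)" if "\<bar>t\<bar> < r" for t
    by (rule refl[OF c']) (use that in auto)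
  have refl_c': "((\<lambda>t. c' (- t)) has_vector_derivative - c'') (at 0)"
    by (rule refl) (use c'' in auto)
  have m': "(?m has_vector_derivative ?m' t) (at t)" if "\<bar>t\<bar> < r" for t
    using bounded_linear.has_vector_derivative[OF bounded_linear_scaleR_right
        has_vector_derivative_add[OF c'[OF that] refl_c[OF that]], of "1/2"]
    by simp
  have m'': "(?m' has_vector_derivative c'') (at 0)"
    using bounded_linear.has_vector_derivative[OF bounded_linear_scaleR_right
        has_vector_derivative_diff[OF c'' refl_c'], of "1/2"]
    by (simp flip: scaleR_2)
  have m0: "?m 0 = c 0" "?m' 0 = 0"
    by (simp_all flip: scaleR_2)
  have contc: "continuous_on ?I c"
    by (intro continuous_at_imp_continuous_on ballI has_vector_derivative_continuous[OF c']) auto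
  have contcm: "continuous_on ?I (\<lambda>t. c (- t))"
    by (intro continuous_at_imp_continuous_on ballI has_vector_derivative_continuous[OF refl_c]) auto
  \<comment> \<open>The midpoint lies in the convex set \<open>S\<close>, but \<open>P\<close> is differentiable there only if it also lies
     in \<open>W\<close>, which holds for small \<open>t\<close>.\<close>
  let ?T = "?I \<inter> c -` W \<inter> (?I \<inter> (\<lambda>t. c (- t)) -` W) \<inter> (?I \<inter> ?m -` W)"
  have "open ?T"
    using \<open>open W\<close> by (intro open_Int continuous_open_preimage contc contcm continuous_intros) auto
  moreover have "0 \<in> ?T"
    using \<open>0 < r\<close> \<open>c 0 \<in> W\<close> m0 by simp
  moreover have "(?\<psi> has_real_derivative ?\<psi>' t) (at t)" if "t \<in> ?T" for t
  proof -
    have t: "\<bar>t\<bar> < r" "c t \<in> W" "c (- t) \<in> W" "?m t \<in> W"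
      using that by auto
    have 1: "((\<lambda>t. P (?m t)) has_vector_derivative P' (?m t) (?m' t)) (at t)"
      by (rule has_vector_derivative_along_curve[OF m' P']) (use t in auto)
    have 2: "((\<lambda>t. P (c t)) has_vector_derivative P' (c t) (c' t)) (at t)"
      by (rule has_vector_derivative_along_curve[OF c' P']) (use t in auto)
    have 3: "((\<lambda>t. P (c (- t))) has_vector_derivative P' (c (- t)) (- c' (- t))) (at t)"
      by (rule has_vector_derivative_along_curve[OF refl_c P']) (use t in auto)
    show ?thesis
      using 1 2 3 unfolding has_real_derivative_iff_has_vector_derivative[symmetric]
      by (auto intro!: derivative_eq_intros simp: blinfun.minus_right)
  qed
  moreover have "(?\<psi>' has_real_derivative - P'' (c' 0) (c' 0)) (at 0)"
  proof -
    have 1: "((\<lambda>t. P' (?m t) (?m' t)) has_vector_derivative P' (c 0) c'') (at 0)"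
      using blinfun_has_vector_derivative_along_curve[OF m'[of 0] _ m'', of P' P''] \<open>0 < r\<close> P'' m0
      by simp
    have 2: "((\<lambda>t. P' (c t) (c' t)) has_vector_derivative
        (P' (c 0) c'' + P'' (c' 0) (c' 0))) (at 0)"
      by (rule blinfun_has_vector_derivative_along_curve[OF c' P'' c'']) (use \<open>0 < r\<close> in auto)
    have 3: "((\<lambda>t. P' (c (- t)) (c' (- t))) has_vector_derivative
        - (P' (c 0) c'' + P'' (c' 0) (c' 0))) (at 0)"
      by (rule refl) (use 2 in simp)
    show ?thesis
      using 1 2 3 unfolding has_real_derivative_iff_has_vector_derivative[symmetric]
      by (auto intro!: derivative_eq_intros simp: field_simps)
  qed
  moreover have "?\<psi> 0 \<le> ?\<psi> t" if "t \<in> ?T" for t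
  proof -
    have "c t \<in> S" "c (- t) \<in> S"
      using that by (auto intro!: cS)
    then have "P (?m t) \<ge> (P (c t) + P (c (- t))) / 2"
      using concave_onD[OF conc, of "1/2" "c t" "c (- t)"]
      by (simp add: scaleR_add_right add_divide_distrib)
    then show ?thesis
      using m0 by simp
  qed
  ultimately have "0 \<le> - P'' (c' 0) (c' 0)"
    by (rule second_derivative_nonneg_at_minimum)
  then show ?thesis
    by simp
qed

section \<open>The differential operators in terms of total derivatives\<close>

lemma partial_deriv_eq:
  assumes "(g has_derivative D) (at x)"
  shows "partial_deriv b g x = D b"
  unfolding partial_deriv_def
  by (rule DERIV_imp_deriv)
     (use has_vector_derivative_on_line[OF assms] in
       \<open>simp add: has_real_derivative_iff_has_vector_derivative\<close>)

lemma gradient_inner_eq: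
  assumes "(g has_derivative D) (at x)"
  shows "gradient g x \<bullet> v = D v"
proof -
  have "D v = D (\<Sum>b\<in>Basis. (v \<bullet> b) *\<^sub>R b)"
    by (simp add: euclidean_representation)
  also have "\<dots> = (\<Sum>b\<in>Basis. (v \<bullet> b) * D b)"
    using has_derivative_linear[OF assms] by (simp add: linear_sum linear_scale)
  finally show ?thesis
    by (simp add: gradient_def partial_deriv_eq[OF assms] inner_sum_right inner_commute[of _ v]
        mult.commute)
qed

lemma laplacian_eq:
  assumes "open W" "x \<in> W"
    and D: "\<And>y. y \<in> W \<Longrightarrow> (g has_derivative D y) (at y)"
    and E: "\<And>b. b \<in> Basis \<Longrightarrow> ((\<lambda>y. D y b) has_derivative E b) (at x)"
  shows "laplacian g x = (\<Sum>b\<in>Basis. E b b)"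
proof -
  have "partial_deriv b (partial_deriv b g) x = E b b" if "b \<in> Basis" for b
    by (rule partial_deriv_eq, rule has_derivative_transform_within_open[OF E[OF that] assms(1,2)])
       (simp add: partial_deriv_eq[OF D])
  then show ?thesis
    by (simp add: laplacian_def)
qed

lemma vec_laplacian_eq:
  fixes u :: "'a::euclidean_space \<Rightarrow> 'b::euclidean_space"
    and u' :: "'a \<Rightarrow> 'a \<Rightarrow>\<^sub>L 'b" and u'' :: "'a \<Rightarrow>\<^sub>L 'a \<Rightarrow>\<^sub>L 'b"
  assumes "open W" "x \<in> W"
    and u': "\<And>y. y \<in> W \<Longrightarrow> (u has_derivative u' y) (at y)"
    and u'': "(u' has_derivative u'') (at x)"
  shows "vec_laplacian u x = (\<Sum>b\<in>Basis. u'' b b)"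
proof -
  have "laplacian (\<lambda>y. u y \<bullet> c) x = (\<Sum>b\<in>Basis. u'' b b \<bullet> c)" for c
  proof (rule laplacian_eq[OF assms(1,2), where E = "\<lambda>b h. u'' h b \<bullet> c"])
    show "((\<lambda>y. u y \<bullet> c) has_derivative (\<lambda>h. u' y h \<bullet> c)) (at y)" if "y \<in> W" for y
      by (rule has_derivative_inner_left[OF u'[OF that]])
    show "((\<lambda>y. u' y b \<bullet> c) has_derivative (\<lambda>h. u'' h b \<bullet> c)) (at x)" for b
      by (intro has_derivative_inner_left
          bounded_linear.has_derivative[OF blinfun.bounded_linear_left u''])
  qed
  then show ?thesis
    by (simp add: vec_laplacian_def inner_sum_left[symmetric] euclidean_representation)
qed

section \<open>Integrals of derivatives of compactly supported functions\<close>

text \<open>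
  The difference quotients of \<open>g\<close> in the direction \<open>b\<close> have integral zero because Lebesgue measure
  is translation invariant. They are bounded by a bound of \<open>g'\<close> and live on a common ball, so
  dominated convergence passes this on to \<open>g'\<close>.
\<close>

lemma integral_partial_derivative_compact_support:
  fixes g g' :: "'a::euclidean_space \<Rightarrow> real"
  assumes K: "compact K" and zero: "\<And>x. x \<notin> K \<Longrightarrow> g x = 0" "\<And>x. x \<notin> K \<Longrightarrow> g' x = 0"
    and deriv: "\<And>x. ((\<lambda>t. g (x + t *\<^sub>R b)) has_real_derivative g' x) (at 0)"
    and cont: "continuous_on UNIV g" "continuous_on UNIV g'"
  shows "integrable lborel g'" "integral\<^sup>L lborel g' = 0"
proof -
  have integrable_if: "integrable lborel h"
    if "continuous_on UNIV h" "\<And>x. x \<notin> K \<Longrightarrow> h x = 0" for h :: "'a \<Rightarrow> real"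
  proof -
    have "integrable lborel (\<lambda>x. indicator K x *\<^sub>R h x)"
      by (rule borel_integrable_compact[OF K continuous_on_subset[OF that(1)]]) simp
    also have "(\<lambda>x. indicator K x *\<^sub>R h x) = h"
      using that(2) by (force simp: indicator_def)
    finally show ?thesis .
  qed
  show "integrable lborel g'"
    by (rule integrable_if) (use cont zero in auto)
  have int_g: "integrable lborel g"
    by (rule integrable_if) (use cont zero in auto)
  have [measurable]: "g \<in> borel_measurable borel" "g' \<in> borel_measurable borel"
    using cont by (auto intro: borel_measurable_continuous_onI)
  obtain B where B: "0 < B" "\<And>x. \<bar>g' x\<bar> \<le> B"
  proof -
    have "bounded (g' ` K)"
      by (intro compact_imp_bounded compact_continuous_image K continuous_on_subset[OF cont(2)]) simp
    then obtain B where "0 < B" "\<And>x. x \<in> K \<Longrightarrow> \<bar>g' x\<bar> \<le> B"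
      by (auto simp: bounded_pos)
    then show ?thesis
      using zero(2) by (intro that[of B]) (force+)
  qed
  have deriv': "((\<lambda>t. g (x + t *\<^sub>R b)) has_real_derivative g' (x + s *\<^sub>R b)) (at s)" for x s
    using DERIV_shift[of "\<lambda>t. g (x + t *\<^sub>R b)" _ 0 s] deriv[of "x + s *\<^sub>R b"]
    by (simp add: algebra_simps)
  have lipschitz: "\<bar>g (x + t *\<^sub>R b) - g x\<bar> \<le> B * t" if "0 < t" for x t
  proof -
    obtain s where "g (x + t *\<^sub>R b) - g (x + 0 *\<^sub>R b) = (t - 0) * g' (x + s *\<^sub>R b)"
      using MVT2[OF \<open>0 < t\<close>, of "\<lambda>t. g (x + t *\<^sub>R b)" "\<lambda>s. g' (x + s *\<^sub>R b)"] deriv' by blast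
    then show ?thesis
      using B(2)[of "x + s *\<^sub>R b"] that by (simp add: abs_mult mult.commute)
  qed
  obtain R where R: "\<And>x. x \<in> K \<Longrightarrow> norm x \<le> R"
    using compact_imp_bounded[OF K] by (auto simp: bounded_iff)
  let ?t = "\<lambda>n. inverse (real (Suc n))"
  let ?q = "\<lambda>n x. (g (x + ?t n *\<^sub>R b) - g x) / ?t n"
  let ?w = "\<lambda>x. indicator (cball 0 (R + norm b)) x *\<^sub>R B"
  have t01: "0 < ?t n" "?t n \<le> 1" for n
    by (auto simp: field_simps)
  have "(\<lambda>n. integral\<^sup>L lborel (?q n)) \<longlonglongrightarrow> integral\<^sup>L lborel g'"
  proof (rule integral_dominated_convergence[where w="?w"])
    show "integrable lborel ?w"
      by (rule borel_integrable_compact) auto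
    show "AE x in lborel. (\<lambda>n. ?q n x) \<longlonglongrightarrow> g' x"
    proof (intro AE_I2)
      fix x
      have "((\<lambda>h. (g (x + h *\<^sub>R b) - g x) / h) \<longlongrightarrow> g' x) (at 0)"
        using deriv[of x] by (simp add: DERIV_def)
      moreover have "filterlim ?t (at 0) sequentially"
        using LIMSEQ_inverse_real_of_nat t01 by (auto simp: filterlim_at intro!: always_eventually)
      ultimately show "(\<lambda>n. ?q n x) \<longlonglongrightarrow> g' x"
        by (rule filterlim_compose)
    qed
    show "AE x in lborel. norm (?q n x) \<le> ?w x" for n
    proof (intro AE_I2)
      fix x
      show "norm (?q n x) \<le> ?w x"
      proof (cases "x \<in> cball 0 (R + norm b)")
        case True
        have "\<bar>?q n x\<bar> = \<bar>g (x + ?t n *\<^sub>R b) - g x\<bar> / ?t n"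
          using t01[of n] by (simp only: abs_divide abs_of_pos)
        also have "\<dots> \<le> B"
          using lipschitz[OF t01(1)[of n]] t01[of n] by (simp only: pos_divide_le_eq)
        finally show ?thesis
          using True by simp
      next
        case False
        have "norm (?t n *\<^sub>R b) \<le> norm b"
          using t01[of n] mult_right_mono[of "?t n" 1 "norm b"] by simp
        then have "norm x \<le> norm (x + ?t n *\<^sub>R b) + norm b"
          using norm_triangle_ineq4[of "x + ?t n *\<^sub>R b" "?t n *\<^sub>R b"] by simp
        then have "x \<notin> K" "x + ?t n *\<^sub>R b \<notin> K"
          using False R[of x] R[of "x + ?t n *\<^sub>R b"] norm_ge_zero[of b] by (auto simp: not_le)
        then show ?thesis
          using False zero by simp
      qed
    qed
  qed auto
  moreover have "integral\<^sup>L lborel (?q n) = 0" for n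
  proof -
    let ?c = "?t n *\<^sub>R b"
    have "integrable (distr lborel borel ((+) ?c)) g"
      using int_g by (simp add: lborel_distr_plus)
    then have int: "integrable lborel (\<lambda>x. g (x + ?c))"
      by (subst (asm) integrable_distr_eq) (auto simp: add.commute)
    have "integral\<^sup>L lborel g = integral\<^sup>L (distr lborel borel ((+) ?c)) g"
      by (simp add: lborel_distr_plus)
    also have "\<dots> = integral\<^sup>L lborel (\<lambda>x. g (x + ?c))"
      by (subst integral_distr) (auto simp: add.commute)
    finally show ?thesis
      using int int_g by (simp del: of_nat_Suc)
  qed
  ultimately show "integral\<^sup>L lborel g' = 0"
    by (auto simp: LIMSEQ_const_iff)
qed

text \<open>Extending \<open>g\<close> and \<open>g'\<close> by zero reduces the claim to functions on the whole space.\<close>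

lemma integral_partial_derivative_compact_support_on:
  fixes g g' :: "'a::euclidean_space \<Rightarrow> real"
  assumes "open \<Omega>" "compact K" "K \<subseteq> \<Omega>" and zero: "\<And>x. x \<in> \<Omega> - K \<Longrightarrow> g x = 0"
    and deriv: "\<And>x. x \<in> \<Omega> \<Longrightarrow> ((\<lambda>t. g (x + t *\<^sub>R b)) has_real_derivative g' x) (at 0)"
    and cont: "continuous_on \<Omega> g" "continuous_on \<Omega> g'"
  shows "integrable (lebesgue_on \<Omega>) g'" "integral\<^sup>L (lebesgue_on \<Omega>) g' = 0"
proof -
  have cover: "\<Omega> \<union> - K = UNIV" and oK: "open (- K)"
    using \<open>K \<subseteq> \<Omega>\<close> compact_imp_closed[OF \<open>compact K\<close>] by auto
  have zero': "g' x = 0" if "x \<in> \<Omega> - K" for x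
  proof -
    have "open {t. x + t *\<^sub>R b \<in> \<Omega> - K}"
      by (intro open_line_vimage open_Diff \<open>open \<Omega>\<close> compact_imp_closed \<open>compact K\<close>)
    then have "((\<lambda>t. g (x + t *\<^sub>R b)) has_real_derivative 0) (at 0)"
      by (rule has_field_derivative_transform_within_open[OF DERIV_const[of 0]])
         (use that zero in auto)
    with deriv[of x] that show ?thesis
      using DERIV_unique by blast
  qed
  let ?ext = "\<lambda>h x. if x \<in> \<Omega> then h x else (0::real)"
  have cont_ext: "continuous_on UNIV (?ext h)"
    if "continuous_on \<Omega> h" "\<And>x. x \<in> \<Omega> - K \<Longrightarrow> h x = 0" for h
  proof -
    have "continuous_on \<Omega> (?ext h)"
      using that(1) by (simp cong: continuous_on_cong)
    moreover have "continuous_on (- K) (?ext h)"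
      by (rule continuous_on_eq[OF continuous_on_const[of _ 0]]) (use that(2) in auto)
    ultimately show ?thesis
      using continuous_on_open_Un[OF \<open>open \<Omega>\<close> oK] cover by metis
  qed
  have ext_deriv: "((\<lambda>t. ?ext g (x + t *\<^sub>R b)) has_real_derivative ?ext g' x) (at 0)" for x
  proof (cases "x \<in> \<Omega>")
    case True
    have "((\<lambda>t. ?ext g (x + t *\<^sub>R b)) has_real_derivative g' x) (at 0)"
      by (rule has_field_derivative_transform_within_open[OF deriv[OF True]
            open_line_vimage[OF \<open>open \<Omega>\<close>, of x b]]) (use True in auto)
    with True show ?thesis
      by simp
  next
    case False
    have "((\<lambda>t. ?ext g (x + t *\<^sub>R b)) has_real_derivative 0) (at 0)"
      by (rule has_field_derivative_transform_within_open[OF DERIV_const[of 0]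
            open_line_vimage[OF oK, of x b]]) (use False zero \<open>K \<subseteq> \<Omega>\<close> in auto)
    with False show ?thesis
      by simp
  qed
  have ind: "(\<lambda>x. indicator \<Omega> x * g' x) = ?ext g'"
    by (auto simp: indicator_def)
  have meas: "?ext g' \<in> borel_measurable lborel"
    using cont_ext[OF cont(2) zero'] by (simp add: borel_measurable_continuous_onI)
  note int = integral_partial_derivative_compact_support[of K "?ext g" "?ext g'" b,
      OF \<open>compact K\<close> _ _ ext_deriv cont_ext[OF cont(1) zero] cont_ext[OF cont(2) zero']]
  have "integrable lborel (?ext g')" "integral\<^sup>L lborel (?ext g') = 0"
    by (rule int; use zero zero' in auto)+
  then show "integrable (lebesgue_on \<Omega>) g'" "integral\<^sup>L (lebesgue_on \<Omega>) g' = 0"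
    using \<open>open \<Omega>\<close> meas
    by (simp_all add: integrable_restrict_space integral_restrict_space ind integrable_completion
        integral_completion)
qed

section \<open>Extended integrals\<close>

lemma ext_integral_mono:
  assumes "\<And>x. x \<in> space M \<Longrightarrow> g x \<le> h x"
  shows "ext_integral M g \<le> ext_integral M h"
  unfolding ext_integral_def
  by (intro ereal_minus_mono)
     (auto simp flip: less_eq_ennreal.rep_eq intro!: nn_integral_mono e2ennreal_mono assms)

lemma ext_integral_eq_integral:
  assumes "integrable M h"
  shows "ext_integral M (\<lambda>x. ereal (h x)) = ereal (integral\<^sup>L M h)"
proof -
  have fin: "(\<integral>\<^sup>+x. ennreal (h x) \<partial>M) \<noteq> \<infinity>" "(\<integral>\<^sup>+x. ennreal (- h x) \<partial>M) \<noteq> \<infinity>"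
    using assms by (auto simp: real_integrable_def)
  have "enn2ereal a = ereal (enn2real a)" if "a \<noteq> \<infinity>" for a
    using that by (cases a) (auto simp: enn2ereal_ennreal)
  with fin show ?thesis
    by (simp add: ext_integral_def real_lebesgue_integral_def[OF assms])
qed

text \<open>
  When \<open>h\<close> is not integrable, the value of its extended integral is decided by which of its parts
  has infinite integral: an infinite positive part makes it \<open>\<infinity>\<close>, also after subtracting the
  integrable \<open>d\<close>, and an infinite negative part alone makes it \<open>- \<infinity>\<close>.
\<close>

lemma ext_integral_le_diff_null_integral:
  fixes h d :: "'a \<Rightarrow> real"
  assumes [measurable]: "h \<in> borel_measurable M" and d: "integrable M d" "integral\<^sup>L M d = 0"
  shows "ext_integral M (\<lambda>x. ereal (h x)) \<le> ext_integral M (\<lambda>x. ereal (h x - d x))"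
proof -
  have [measurable]: "d \<in> borel_measurable M"
    using d by auto
  let ?A = "\<integral>\<^sup>+x. ennreal (h x) \<partial>M" and ?B = "\<integral>\<^sup>+x. ennreal (- h x) \<partial>M"
  consider "?A = \<infinity>" | "?A \<noteq> \<infinity>" "?B = \<infinity>" | "?A \<noteq> \<infinity>" "?B \<noteq> \<infinity>"
    by blast
  then show ?thesis
  proof cases
    case 1
    have "?A \<le> (\<integral>\<^sup>+x. ennreal (h x - d x) + ennreal (d x) \<partial>M)"
    proof (intro nn_integral_mono)
      fix x
      show "ennreal (h x) \<le> ennreal (h x - d x) + ennreal (d x)"
        using ennreal_plus_if ennreal_leI
        by (smt (verit) add.commute add_0 ennreal_neg nle_le)
    qed
    also have "\<dots> = (\<integral>\<^sup>+x. ennreal (h x - d x) \<partial>M) + (\<integral>\<^sup>+x. ennreal (d x) \<partial>M)"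
      by (rule nn_integral_add) auto
    finally have "(\<integral>\<^sup>+x. ennreal (h x - d x) \<partial>M) = \<infinity>"
      using 1 d(1) by (auto simp: real_integrable_def top_unique)
    then show ?thesis
      by (simp add: ext_integral_def)
  next
    case 2
    then have "ext_integral M (\<lambda>x. ereal (h x)) = - \<infinity>"
      by (cases ?A) (auto simp: ext_integral_def enn2ereal_ennreal)
    then show ?thesis
      by simp
  next
    case 3
    then have "integrable M h"
      by (simp add: real_integrable_def)
    with d show ?thesis
      by (simp add: ext_integral_eq_integral)
  qed
qed

lemma ext_integral_return:
  assumes "x \<in> space M" "g \<in> borel_measurable M"
  shows "ext_integral (return M x) (\<lambda>z. ereal (g z)) = ereal (g x)"
proof -
  interpret prob_space "return M x"
    by (rule prob_space_return[OF assms(1)])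
  have "ennreal (g x) \<noteq> \<infinity>" "ennreal (- g x) \<noteq> \<infinity>"
    by auto
  then have "integrable (return M x) g"
    using assms by (simp add: real_integrable_def nn_integral_return)
  then show ?thesis
    using assms by (simp add: ext_integral_eq_integral integral_return)
qed

section \<open>The flux of a potential along the graph\<close>

text \<open>
  The total first and second derivatives of \<open>p\<close> and \<open>u\<close> are parameters, so that all partial
  derivatives can be written as their values at vectors of the form \<open>(b, 0)\<close> and \<open>(0, v)\<close>.
\<close>

locale potential_on_graph =
  fixes \<Omega> :: "'a::euclidean_space set" and \<Gamma> :: "'b::euclidean_space set"
    and W :: "('a \<times> 'b) set" and p :: "'a \<times> 'b \<Rightarrow> real"
    and p' :: "'a \<times> 'b \<Rightarrow> ('a \<times> 'b) \<Rightarrow>\<^sub>L real"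
    and p'' :: "'a \<times> 'b \<Rightarrow> ('a \<times> 'b) \<Rightarrow>\<^sub>L ('a \<times> 'b) \<Rightarrow>\<^sub>L real"
    and u :: "'a \<Rightarrow> 'b" and u' :: "'a \<Rightarrow> 'a \<Rightarrow>\<^sub>L 'b" and u'' :: "'a \<Rightarrow> 'a \<Rightarrow>\<^sub>L 'a \<Rightarrow>\<^sub>L 'b"
  assumes open_domain: "open \<Omega>" and open_W: "open W" and product_subset: "\<Omega> \<times> \<Gamma> \<subseteq> W"
    and p': "\<And>w. w \<in> W \<Longrightarrow> (p has_derivative p' w) (at w)"
    and p'': "\<And>w. w \<in> W \<Longrightarrow> (p' has_derivative p'' w) (at w)"
    and cont_p'': "continuous_on W p''"
    and u': "\<And>x. x \<in> \<Omega> \<Longrightarrow> (u has_derivative u' x) (at x)"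
    and u'': "\<And>x. x \<in> \<Omega> \<Longrightarrow> (u' has_derivative u'' x) (at x)"
    and cont_u'': "continuous_on \<Omega> u''"
    and u_in: "\<And>x. x \<in> \<Omega> \<Longrightarrow> u x \<in> \<Gamma>"
begin

definition flux :: "'a \<Rightarrow> 'a \<Rightarrow> real" where
  "flux b x = p' (x, u x) (b, - u' x b)"

text \<open>
  The derivative of the component \<open>flux b\<close> in its own direction \<open>b\<close>; summed over the basis, this is
  the divergence of the flux.
\<close>

definition flux_deriv :: "'a \<Rightarrow> 'a \<Rightarrow> real" where
  "flux_deriv b x = p' (x, u x) (0, - u'' x b b) + p'' (x, u x) (b, u' x b) (b, - u' x b)"

lemma graph_in_W: "x \<in> \<Omega> \<Longrightarrow> (x, u x) \<in> W"
  using product_subset u_in by auto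

lemma graph_has_vector_derivative:
  assumes "x + t *\<^sub>R b \<in> \<Omega>"
  shows "((\<lambda>t. u (x + t *\<^sub>R b)) has_vector_derivative u' (x + t *\<^sub>R b) b) (at t)"
  by (rule has_vector_derivative_along_curve[OF has_vector_derivative_line u'[OF assms]])

lemma graph_derivative_has_vector_derivative:
  assumes "x \<in> \<Omega>"
  shows "((\<lambda>t. u' (x + t *\<^sub>R b) b) has_vector_derivative u'' x b b) (at 0)"
  using has_vector_derivative_on_line[OF bounded_linear.has_derivative[OF
      blinfun.bounded_linear_left u''[OF assms]], of b b] .

lemma flux_has_derivative:
  assumes "x \<in> \<Omega>"
  shows "((\<lambda>t. flux b (x + t *\<^sub>R b)) has_real_derivative flux_deriv b x) (at 0)"
proof -
  have c: "((\<lambda>t. (x + t *\<^sub>R b, u (x + t *\<^sub>R b))) has_vector_derivative (b, u' x b)) (at 0)"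
    using graph_has_vector_derivative[of x 0 b] assms
    by (intro has_vector_derivative_Pair has_vector_derivative_line) simp
  have v: "((\<lambda>t. (b, - u' (x + t *\<^sub>R b) b)) has_vector_derivative (0, - u'' x b b)) (at 0)"
    by (intro has_vector_derivative_Pair has_vector_derivative_const has_vector_derivative_minus
        graph_derivative_has_vector_derivative[OF assms])
  from blinfun_has_vector_derivative_along_curve[OF c _ v, of p' "p'' (x, u x)"]
  show ?thesis
    using p''[OF graph_in_W[OF assms]]
    by (simp add: flux_def flux_deriv_def has_real_derivative_iff_has_vector_derivative)
qed

lemma continuous_on_graph: "continuous_on \<Omega> (\<lambda>x. (x, u x))"
  by (intro continuous_intros continuous_at_imp_continuous_on ballI has_derivative_continuous[OF u'])

lemma continuous_on_flux: "continuous_on \<Omega> (flux b)" "continuous_on \<Omega> (flux_deriv b)"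
proof -
  have "continuous_on W p'"
    by (intro continuous_at_imp_continuous_on ballI has_derivative_continuous[OF p''])
  then have 1: "continuous_on \<Omega> (\<lambda>x. p' (x, u x))"
    by (rule continuous_on_compose2[OF _ continuous_on_graph]) (auto simp: graph_in_W)
  have 2: "continuous_on \<Omega> (\<lambda>x. p'' (x, u x))"
    by (rule continuous_on_compose2[OF cont_p'' continuous_on_graph]) (auto simp: graph_in_W)
  have 3: "continuous_on \<Omega> u'"
    by (intro continuous_at_imp_continuous_on ballI has_derivative_continuous[OF u''])
  show "continuous_on \<Omega> (flux b)" "continuous_on \<Omega> (flux_deriv b)"
    unfolding flux_def flux_deriv_def
    by (intro continuous_intros 1 2 3 cont_u'')+
qed

text \<open>
  Writing \<open>(b, - \<partial>\<^sub>b u) = 2 (b, 0) - (b, \<partial>\<^sub>b u)\<close> expresses the flux by the derivatives of \<open>p\<close> along the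
  curves \<open>(x + t b, u x)\<close> and \<open>(x + t b, u (x + t b))\<close>. For small \<open>t\<close> both stay in \<open>\<Omega> \<times> \<Gamma>\<close>, where \<open>p\<close> is known
  to vanish near \<open>x\<close>; a curve moving in \<open>z\<close> alone could leave \<open>\<Gamma>\<close>.
\<close>

lemma flux_eq_0_outside_support:
  assumes supp: "\<And>y z. y \<in> \<Omega> - K \<Longrightarrow> z \<in> \<Gamma> \<Longrightarrow> p (y, z) = 0" and "closed K" "x \<in> \<Omega> - K"
  shows "flux b x = 0"
proof -
  have x: "x \<in> \<Omega>"
    using assms by simp
  have op: "open {t. x + t *\<^sub>R b \<in> \<Omega> - K}"
    by (rule open_line_vimage) (use open_domain \<open>closed K\<close> in auto)
  have zero: "p' (x, u x) v = 0"
    if c: "((\<lambda>t. (x + t *\<^sub>R b, c t)) has_vector_derivative v) (at 0)" "c 0 = u x"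
      and mem: "\<And>t. x + t *\<^sub>R b \<in> \<Omega> - K \<Longrightarrow> c t \<in> \<Gamma>" for c v
  proof -
    have "((\<lambda>t. p (x + t *\<^sub>R b, c t)) has_vector_derivative p' (x, u x) v) (at 0)"
      by (rule has_vector_derivative_along_curve[OF c(1)]) (use p' graph_in_W[OF x] c(2) in auto)
    moreover have "((\<lambda>t. p (x + t *\<^sub>R b, c t)) has_vector_derivative 0) (at 0)"
      by (rule has_vector_derivative_transform_within_open[OF has_vector_derivative_const op])
         (use assms mem supp in auto)
    ultimately show ?thesis
      by (rule vector_derivative_unique_at)
  qed
  have "p' (x, u x) (b, 0) = 0"
    by (rule zero[of "\<lambda>_. u x"])
       (auto intro!: has_vector_derivative_Pair has_vector_derivative_line u_in x)
  moreover have "p' (x, u x) (b, u' x b) = 0"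
    by (rule zero[of "\<lambda>t. u (x + t *\<^sub>R b)"])
       (use graph_has_vector_derivative[of x 0 b] x in
         \<open>auto intro!: has_vector_derivative_Pair has_vector_derivative_line u_in\<close>)
  moreover have "(b, - u' x b) = 2 *\<^sub>R (b, 0) - (b, u' x b)"
    by (simp add: scaleR_2)
  ultimately show ?thesis
    unfolding flux_def by (simp only: blinfun.diff_right blinfun.scaleR_right) simp
qed

lemma slice_laplacian:
  assumes "x \<in> \<Omega>" "z \<in> \<Gamma>"
  shows "laplacian (\<lambda>y. p (y, z)) x = (\<Sum>b\<in>Basis. p'' (x, z) (b, 0) (b, 0))"
proof (rule laplacian_eq[OF open_domain \<open>x \<in> \<Omega>\<close>,
      where E = "\<lambda>b h. p'' (x, z) (h, 0) (b, 0)"])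
  have pair: "((\<lambda>y. (y, z)) has_derivative (\<lambda>h. (h, 0))) (at y)" for y
    by (auto intro!: derivative_eq_intros)
  show "((\<lambda>y. p (y, z)) has_derivative (\<lambda>h. p' (y, z) (h, 0))) (at y)" if "y \<in> \<Omega>" for y
    by (rule has_derivative_compose[OF pair p']) (use that assms product_subset in auto)
  show "((\<lambda>y. p' (y, z) (b, 0)) has_derivative (\<lambda>h. p'' (x, z) (h, 0) (b, 0))) (at x)" for b
    by (rule bounded_linear.has_derivative[OF blinfun.bounded_linear_left
          has_derivative_compose[OF pair p'']]) (use assms product_subset in auto)
qed

lemma slice_gradient:
  assumes "x \<in> \<Omega>" "z \<in> \<Gamma>"
  shows "gradient (\<lambda>w. p (x, w)) z \<bullet> v = p' (x, z) (0, v)"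
proof (rule gradient_inner_eq)
  have pair: "((\<lambda>w. (x, w)) has_derivative (\<lambda>h. (0, h))) (at z)"
    by (auto intro!: derivative_eq_intros)
  show "((\<lambda>w. p (x, w)) has_derivative (\<lambda>h. p' (x, z) (0, h))) (at z)"
    by (rule has_derivative_compose[OF pair p']) (use assms product_subset in auto)
qed

lemma vertical_second_derivative_nonpos:
  assumes conc: "concave_on (convex hull \<Gamma>) (\<lambda>z. p (x, z))" and x: "x \<in> \<Omega>"
  shows "p'' (x, u x) (0, u' x b) (0, u' x b) \<le> 0"
proof -
  obtain r where r: "0 < r" "\<And>t. \<bar>t\<bar> < r \<Longrightarrow> x + t *\<^sub>R b \<in> \<Omega>"
  proof -
    have "open {t. x + t *\<^sub>R b \<in> \<Omega>}" "0 \<in> {t. x + t *\<^sub>R b \<in> \<Omega>}"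
      using open_line_vimage[OF open_domain] x by auto
    then obtain r where "0 < r" "ball 0 r \<subseteq> {t. x + t *\<^sub>R b \<in> \<Omega>}"
      by (meson openE)
    then show ?thesis
      by (intro that[of r]) auto
  qed
  let ?c = "\<lambda>t. (x, u (x + t *\<^sub>R b))" and ?c' = "\<lambda>t. (0, u' (x + t *\<^sub>R b) b)"
  have "p'' (x, u x) (?c' 0) (?c' 0) \<le> 0"
  proof (rule second_derivative_nonpos_if_concave_along_curve[OF open_W _ _ p' _ r(1)])
    show "?c 0 \<in> W"
      using graph_in_W[OF x] by simp
    show "concave_on ({x} \<times> (convex hull \<Gamma>)) p"
      using conc unfolding concave_on_iff
      by (auto intro!: convex_Times simp flip: scaleR_left.add)
    show "(p' has_derivative p'' (x, u x)) (at (?c 0))"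
      using p''[OF graph_in_W[OF x]] by simp
    show "(?c has_vector_derivative ?c' t) (at t)" if "\<bar>t\<bar> < r" for t
      by (intro has_vector_derivative_Pair has_vector_derivative_const
          graph_has_vector_derivative r(2) that)
    show "(?c' has_vector_derivative (0, u'' x b b)) (at 0)"
      by (intro has_vector_derivative_Pair has_vector_derivative_const
          graph_derivative_has_vector_derivative x)
    show "?c t \<in> {x} \<times> (convex hull \<Gamma>)" if "\<bar>t\<bar> < r" for t
      using hull_inc[OF u_in[OF r(2)[OF that]]] by auto
  qed
  then show ?thesis
    by simp
qed

text \<open>
  With \<open>v = \<partial>\<^sub>b u\<close>, expanding \<open>p'' (b, v) (b, - v)\<close> gives \<open>p'' (b, 0) (b, 0) - p'' (0, v) (0, v)\<close> and
  two mixed terms of opposite sign, which cancel by symmetry. This is why the flux carries the minus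
  sign in its second component.
\<close>

lemma laplacian_le_divergence_flux:
  assumes conc: "concave_on (convex hull \<Gamma>) (\<lambda>z. p (x, z))" and x: "x \<in> \<Omega>"
  shows "laplacian (\<lambda>y. p (y, u x)) x
    \<le> gradient (\<lambda>w. p (x, w)) (u x) \<bullet> vec_laplacian u x + (\<Sum>b\<in>Basis. flux_deriv b x)"
proof -
  have "p'' (x, u x) (b, 0) (b, 0) \<le> p' (x, u x) (0, u'' x b b) + flux_deriv b x" for b
  proof -
    let ?w = "(x, u x)" and ?v = "u' x b"
    have split: "(b, ?v) = (b, 0) + (0, ?v)" "(b, - ?v) = (b, 0) - (0, ?v)"
      "(0, - u'' x b b) = - (0 :: 'a, u'' x b b)"
      by auto
    have sym: "p'' ?w (b, 0) (0, ?v) = p'' ?w (0, ?v) (b, 0)"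
      by (rule second_derivative_symmetric[OF open_W graph_in_W[OF x] p' p'' cont_p''])
    have "flux_deriv b x =
        p'' ?w (b, 0) (b, 0) - p'' ?w (0, ?v) (0, ?v) - p' ?w (0, u'' x b b)"
      unfolding flux_deriv_def split
      by (simp only: blinfun.add_left blinfun.add_right blinfun.diff_right blinfun.minus_right
          plus_blinfun.rep_eq sym)
    with vertical_second_derivative_nonpos[OF conc x, of b] show ?thesis
      by simp
  qed
  then have "(\<Sum>b\<in>Basis. p'' (x, u x) (b, 0) (b, 0))
      \<le> (\<Sum>b\<in>Basis. p' (x, u x) (0, u'' x b b)) + (\<Sum>b\<in>Basis. flux_deriv b x)"
    unfolding sum.distrib[symmetric] by (intro sum_mono)
  moreover have "(\<Sum>b\<in>Basis. p' (x, u x) (0, u'' x b b)) = p' (x, u x) (0, vec_laplacian u x)"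
    by (simp add: vec_laplacian_eq[OF open_domain x u' u''[OF x]] sum_prod
        flip: blinfun.sum_right)
  ultimately show ?thesis
    using x u_in[OF x] by (simp add: slice_laplacian slice_gradient)
qed

end

section \<open>The lifted energy at a Dirac lifting\<close>

theorem proposition1:
  fixes \<Omega> :: "(real ^ 'd) set" and \<Gamma> :: "(real ^ 's) set"
    and f :: "real ^ 'd \<Rightarrow> real ^ 's \<Rightarrow> real ^ 's \<Rightarrow> real"
    and u :: "real ^ 'd \<Rightarrow> real ^ 's"
    and U :: "real ^ 'd \<Rightarrow> (real ^ 's) measure"
  assumes "open \<Omega>" and "bounded \<Omega>" and "bounded \<Gamma>"
    and "\<And>v. measurable_integrand \<Omega> \<Gamma> (\<lambda>(x, z). f x z v)"
    and "\<And>x z. x \<in> \<Omega> \<Longrightarrow> z \<in> \<Gamma> \<Longrightarrow> convex_on UNIV (f x z)"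
    and "C2_on \<Omega> u" and "u \<in> \<Omega> \<rightarrow> \<Gamma>"
    and "\<And>x. x \<in> \<Omega> \<Longrightarrow> U x = return (restrict_space borel \<Gamma>) (u x)"
  shows "energy \<Omega> f u \<ge> lifted_energy \<Omega> \<Gamma> f U"
  unfolding lifted_energy_def
proof (rule SUP_least, clarify)
  fix p q
  assume "(p, q) \<in> admissible \<Omega> \<Gamma> f"
  then have p: "C2_on (\<Omega> \<times> \<Gamma>) p" "compact (closure {w \<in> \<Omega> \<times> \<Gamma>. p w \<noteq> 0})"
      "closure {w \<in> \<Omega> \<times> \<Gamma>. p w \<noteq> 0} \<subseteq> \<Omega> \<times> \<Gamma>"
    and q: "measurable_integrand \<Omega> \<Gamma> q"
    and conc: "\<And>x. x \<in> \<Omega> \<Longrightarrow> concave_on (convex hull \<Gamma>) (\<lambda>z. p (x, z))"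
    and dual: "\<And>x z. x \<in> \<Omega> \<Longrightarrow> z \<in> \<Gamma> \<Longrightarrow>
      ereal (q (x, z)) + conjugate f x z (gradient (\<lambda>w. p (x, w)) z) \<le> 0"
    by (auto simp: admissible_def C2_compact_support_def)
  obtain W and p' :: "_ \<Rightarrow> ((real ^ 'd) \<times> (real ^ 's)) \<Rightarrow>\<^sub>L real" and p''
    where W: "open W" "\<Omega> \<times> \<Gamma> \<subseteq> W" "\<forall>x\<in>W. (p has_derivative p' x) (at x)"
      "\<forall>x\<in>W. (p' has_derivative blinfun_apply (p'' x)) (at x)" "continuous_on W p''"
    using p(1) unfolding C2_on_def by blast
  obtain W\<^sub>u and u' :: "_ \<Rightarrow> (real ^ 'd) \<Rightarrow>\<^sub>L (real ^ 's)" and u''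
    where u: "open W\<^sub>u" "\<Omega> \<subseteq> W\<^sub>u" "\<forall>x\<in>W\<^sub>u. (u has_derivative u' x) (at x)"
      "\<forall>x\<in>W\<^sub>u. (u' has_derivative blinfun_apply (u'' x)) (at x)" "continuous_on W\<^sub>u u''"
    using assms(6) unfolding C2_on_def by blast
  interpret potential_on_graph \<Omega> \<Gamma> W p p' p'' u u' u''
    by unfold_locales
       (use \<open>open \<Omega>\<close> W u \<open>u \<in> \<Omega> \<rightarrow> \<Gamma>\<close> continuous_on_subset in \<open>auto simp: Pi_iff\<close>)
  define K where "K = fst ` closure {w \<in> \<Omega> \<times> \<Gamma>. p w \<noteq> 0}"
  have K: "compact K" "K \<subseteq> \<Omega>"
    using p(2,3) by (auto simp: K_def intro!: compact_continuous_image continuous_intros)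
  have supp: "p (y, z) = 0" if "y \<in> \<Omega> - K" "z \<in> \<Gamma>" for y z
  proof (rule ccontr)
    assume "p (y, z) \<noteq> 0"
    then have "(y, z) \<in> closure {w \<in> \<Omega> \<times> \<Gamma>. p w \<noteq> 0}"
      using that by (intro subsetD[OF closure_subset]) auto
    then have "y \<in> K"
      unfolding K_def by force
    with that show False
      by simp
  qed
  \<comment> \<open>The divergence of the flux.\<close>
  define d where "d x = (\<Sum>b\<in>Basis. flux_deriv b x)" for x
  note int_flux_deriv = integral_partial_derivative_compact_support_on[OF \<open>open \<Omega>\<close> K
      flux_eq_0_outside_support[OF supp compact_imp_closed[OF K(1)]]
      flux_has_derivative continuous_on_flux]
  have d: "integrable (lebesgue_on \<Omega>) d" "integral\<^sup>L (lebesgue_on \<Omega>) d = 0"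
    unfolding d_def using int_flux_deriv by (simp_all add: Bochner_Integration.integral_sum)
  define h where "h x z = laplacian (\<lambda>y. p (y, z)) x + q (x, z)" for x z
  have cont_lap: "continuous_on (\<Omega> \<times> \<Gamma>) (\<lambda>(x, z). laplacian (\<lambda>y. p (y, z)) x)"
  proof (rule continuous_on_eq)
    show "continuous_on (\<Omega> \<times> \<Gamma>) (\<lambda>w. \<Sum>b\<in>Basis. p'' w (b, 0) (b, 0))"
      by (intro continuous_intros continuous_on_subset[OF cont_p'' product_subset])
  qed (auto simp: slice_laplacian)
  have q_meas: "q \<in> borel_measurable (lebesgue_on \<Omega> \<Otimes>\<^sub>M restrict_space borel \<Gamma>)"
    using q by (simp add: measurable_integrand_def)
  have h_slice: "h x \<in> borel_measurable (restrict_space borel \<Gamma>)" if "x \<in> \<Omega>" for x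
  proof -
    have "continuous_on \<Gamma> (\<lambda>z. laplacian (\<lambda>y. p (y, z)) x)"
      using continuous_on_compose2[OF cont_lap continuous_on_Pair[OF continuous_on_const
            continuous_on_id], of x \<Gamma>] that
      by auto
    then have "(\<lambda>z. laplacian (\<lambda>y. p (y, z)) x) \<in> borel_measurable (restrict_space borel \<Gamma>)"
      by (rule borel_measurable_continuous_on_restrict)
    moreover have "(\<lambda>z. q (x, z)) \<in> borel_measurable (restrict_space borel \<Gamma>)"
      by (rule measurable_Pair2[OF q_meas]) (use that in simp)
    ultimately show ?thesis
      unfolding h_def by simp
  qed
  have h_graph: "(\<lambda>x. h x (u x)) \<in> borel_measurable (lebesgue_on \<Omega>)"
  proof -
    have cont_u: "continuous_on \<Omega> u"
      using continuous_on_snd[OF continuous_on_graph] by simp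
    have "continuous_on \<Omega> (\<lambda>x. laplacian (\<lambda>y. p (y, u x)) x)"
      using continuous_on_compose2[OF cont_lap continuous_on_graph] u_in by auto
    then have "(\<lambda>x. laplacian (\<lambda>y. p (y, u x)) x) \<in> borel_measurable (lebesgue_on \<Omega>)"
      by (rule continuous_imp_measurable_on_sets_lebesgue) (use \<open>open \<Omega>\<close> in auto)
    moreover have "u \<in> lebesgue_on \<Omega> \<rightarrow>\<^sub>M restrict_space borel \<Gamma>"
      by (rule measurable_restrict_space2)
         (use \<open>open \<Omega>\<close> u_in in
           \<open>auto intro!: continuous_imp_measurable_on_sets_lebesgue[OF cont_u]\<close>)
    then have "(\<lambda>x. q (x, u x)) \<in> borel_measurable (lebesgue_on \<Omega>)"
      by (intro measurable_compose[OF _ q_meas] measurable_Pair measurable_ident_sets[OF refl])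
    ultimately show ?thesis
      unfolding h_def by simp
  qed
  have h_le: "h x (u x) - d x \<le> f x (u x) (vec_laplacian u x)" if x: "x \<in> \<Omega>" for x
  proof -
    let ?g = "gradient (\<lambda>w. p (x, w)) (u x)" and ?v = "vec_laplacian u x"
    \<comment> \<open>Fenchel's inequality with the vector \<open>\<Delta>u(x)\<close>.\<close>
    have "ereal (?g \<bullet> ?v - f x (u x) ?v) \<le> conjugate f x (u x) ?g"
      unfolding conjugate_def by (rule SUP_upper) simp
    then have "ereal (q (x, u x)) + ereal (?g \<bullet> ?v - f x (u x) ?v) \<le> 0"
      using dual[OF x u_in[OF x]] by (meson add_left_mono order_trans)
    then have "q (x, u x) \<le> f x (u x) ?v - ?g \<bullet> ?v"
      by simp
    with laplacian_le_divergence_flux[OF conc[OF x] x] show ?thesis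
      by (simp add: h_def d_def)
  qed
  have inner: "ext_integral (U x) (\<lambda>z. ereal (h x z)) = ereal (h x (u x))" if "x \<in> \<Omega>" for x
    using ext_integral_return[OF _ h_slice[OF that], of "u x"] u_in[OF that] assms(8)[OF that]
    by (simp add: space_restrict_space)
  have "ext_integral (lebesgue_on \<Omega>) (\<lambda>x. ext_integral (U x) (\<lambda>z. ereal (h x z)))
      \<le> ext_integral (lebesgue_on \<Omega>) (\<lambda>x. ereal (h x (u x)))"
    by (rule ext_integral_mono) (simp add: inner)
  also have "\<dots> \<le> ext_integral (lebesgue_on \<Omega>) (\<lambda>x. ereal (h x (u x) - d x))"
    by (rule ext_integral_le_diff_null_integral[OF h_graph d])
  also have "\<dots> \<le> energy \<Omega> f u"
    unfolding energy_def by (rule ext_integral_mono) (simp add: h_le)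
  finally show "ext_integral (lebesgue_on \<Omega>)
      (\<lambda>x. ext_integral (U x) (\<lambda>z. ereal (laplacian (\<lambda>y. p (y, z)) x + q (x, z))))
      \<le> energy \<Omega> f u"
    by (simp add: h_def)
qed

end
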